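(* Let $E$ be a non-empty finite set and let $\mu$ be a probability measure on $\Omega=\{0,1\}^E$. Suppose that $S_\mu=\{\omega\in\Omega:\mu(\omega)>0\}$ is increasing (if $\omega\in S_\mu$ and $\omega\le\omega'$ coordinatewise then $\omega'\in S_\mu$) and that $1\in S_\mu$. Let $T$ be the coalescence time and $A_0(T)$ the output of the coupling-from-the-past bounding-chain algorithm for $\mu$ described in the context. Then $P(T<\infty)=1$, and $A_0(T)$ has law $\mu$.
   Context: $\Omega=\{0,1\}^E$ carries the coordinatewise partial order; $1$ and $0$ also denote the configurations of all $1$'s and all $0$'s. For $\xi\in\Omega$ and $e\in E$, $\xi_e$ denotes the restriction of $\xi$ to $E\setminus\{e\}$, and $\xi_e^b$ ($b\in\{0,1\}$) denotes the configuration that agrees with $\xi$ off $e$ and takes the value $b$ at $e$. Conditional probabilities: $1_e$ is the indicator function that $e$ is open (i.e. that the configuration takes the value $1$ at $e$). If $\xi_e^1\in S_\mu$, then $\mu(1_e\mid\xi_e)=\mu(\xi_e^1)/(\mu(\xi_e^1)+\mu(\xi_e^0))$ is the usual conditional probability. If $\xi_e^1\notin S_\mu$, we set by definition $\mu(1_e\mid\xi_e)=\max\{\mu(1_e\mid\psi_e):\psi_e\ge\xi_e,\ \psi_e^1\in S_\mu\}$. Update rule: given a pair $(\xi,\eta)\in\Omega^2$ with $\xi\le\eta$, an element $e\in E$ and $U\in[0,1]$, define $\alpha=\min\{\mu(1_e\mid\psi_e):\xi_e\le\psi_e\le\eta_e\}$ and $\beta=\max\{\mu(1_e\mid\psi_e):\xi_e\le\psi_e\le\eta_e\}$.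 The updated pair $(\xi',\eta')$ has $\xi'(f)=\xi(f)$, $\eta'(f)=\eta(f)$ for $f\ne e$, and $\xi'(e)=1$ if and only if $U\le\alpha$, $\eta'(e)=1$ if and only if $U\le\beta$. (Then $\xi'\le\eta'$.) Algorithm: let $(e_n,U_n)_{n\le0}$ be independent, with $e_n$ uniformly distributed on $E$, $U_n$ uniformly distributed on $[0,1]$, and $e_n$, $U_n$ independent. For each $m\ge0$, let $(A_k(m),B_k(m):-m\le k\le0)$ be defined by $A_{-m}(m)=0$, $B_{-m}(m)=1$, and, for $-m<k\le0$, $(A_k(m),B_k(m))$ is obtained from $(A_{k-1}(m),B_{k-1}(m))$ by the update rule using $(e_k,U_k)$; the same sequence $(e_n,U_n)_{n\le0}$ is used for all $m$. The coalescence time is $T=\min\{m\ge0:A_0(m)=B_0(m)\}$ (with $T=\infty$ if there is no such $m$), so that $A_0(T)=B_0(T)$ when $T<\infty$. *)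

theory Defs
  imports "HOL-Probability.Probability"
begin

text \<open>
  The finite non-empty set \<open>E\<close> is a type \<open>'e\<close> of class \<^class>\<open>finite\<close>. A configuration is a function
  \<open>'e \<Rightarrow> bool\<close>, where \<^const>\<open>True\<close> stands for \<open>1\<close>; the order \<open>\<le>\<close> on functions is the
  coordinatewise one.
\<close>

type_synonym 'e config = "'e \<Rightarrow> bool"

text \<open>
  The restriction \<open>\<xi>\<^sub>e\<close> of \<open>\<xi>\<close> to \<open>E - {e}\<close> is represented by any of its extensions to \<open>E\<close>:
  \<open>le_off e \<xi> \<psi>\<close> says \<open>\<xi>\<^sub>e \<le> \<psi>\<^sub>e\<close>, and \<open>cond_usual\<close>, \<open>cond_open\<close> below
  do not depend on the value of \<open>\<xi>\<close> at \<open>e\<close>.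
\<close>

definition le_off :: "'e \<Rightarrow> 'e config \<Rightarrow> 'e config \<Rightarrow> bool" where
  "le_off e \<xi> \<psi> \<longleftrightarrow> (\<forall>f. f \<noteq> e \<longrightarrow> \<xi> f \<le> \<psi> f)"

definition cond_usual :: "'e config pmf \<Rightarrow> 'e \<Rightarrow> 'e config \<Rightarrow> real" where
  "cond_usual \<mu> e \<xi> =
     pmf \<mu> (\<xi>(e := True)) / (pmf \<mu> (\<xi>(e := True)) + pmf \<mu> (\<xi>(e := False)))"

text \<open>\<open>\<mu>(1\<^sub>e | \<xi>\<^sub>e)\<close>, including the convention when \<open>\<xi>\<close> opened at \<open>e\<close> is outside the support.\<close>

definition cond_open :: "'e::finite config pmf \<Rightarrow> 'e \<Rightarrow> 'e config \<Rightarrow> real" where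
  "cond_open \<mu> e \<xi> =
     (if \<xi>(e := True) \<in> set_pmf \<mu> then cond_usual \<mu> e \<xi>
      else Max {cond_usual \<mu> e \<psi> |\<psi>. le_off e \<xi> \<psi> \<and> \<psi>(e := True) \<in> set_pmf \<mu>})"

definition lower_prob :: "'e::finite config pmf \<Rightarrow> 'e \<Rightarrow> 'e config \<Rightarrow> 'e config \<Rightarrow> real" where
  "lower_prob \<mu> e \<xi> \<eta> = Min {cond_open \<mu> e \<psi> |\<psi>. le_off e \<xi> \<psi> \<and> le_off e \<psi> \<eta>}"

definition upper_prob :: "'e::finite config pmf \<Rightarrow> 'e \<Rightarrow> 'e config \<Rightarrow> 'e config \<Rightarrow> real" where
  "upper_prob \<mu> e \<xi> \<eta> = Max {cond_open \<mu> e \<psi> |\<psi>. le_off e \<xi> \<psi> \<and> le_off e \<psi> \<eta>}"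

fun update_pair ::
  "'e::finite config pmf \<Rightarrow> 'e \<Rightarrow> real \<Rightarrow> 'e config \<times> 'e config \<Rightarrow> 'e config \<times> 'e config" where
  "update_pair \<mu> e u (\<xi>, \<eta>) =
     (\<xi>(e := (u \<le> lower_prob \<mu> e \<xi> \<eta>)), \<eta>(e := (u \<le> upper_prob \<mu> e \<xi> \<eta>)))"

text \<open>
  \<open>run_from \<mu> es us m j\<close> is the pair at time \<open>-m + j\<close> of the chain started at time \<open>-m\<close>; the step
  to time \<open>k\<close> uses \<open>(es k, us k)\<close>. Only times \<open>k \<le> 0\<close> matter.
\<close>

fun run_from ::
  "'e::finite config pmf \<Rightarrow> (int \<Rightarrow> 'e) \<Rightarrow> (int \<Rightarrow> real) \<Rightarrow> nat \<Rightarrow> nat \<Rightarrow> 'e config \<times> 'e config"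
where
  "run_from \<mu> es us m 0 = ((\<lambda>_. False), (\<lambda>_. True))"
| "run_from \<mu> es us m (Suc j) =
     (let k = - int m + int (Suc j) in update_pair \<mu> (es k) (us k) (run_from \<mu> es us m j))"

text \<open>\<open>A\<^sub>k(m)\<close> and \<open>B\<^sub>k(m)\<close>, meaningful for \<open>-m \<le> k \<le> 0\<close>.\<close>

definition chain_A ::
  "'e::finite config pmf \<Rightarrow> (int \<Rightarrow> 'e) \<Rightarrow> (int \<Rightarrow> real) \<Rightarrow> nat \<Rightarrow> int \<Rightarrow> 'e config" where
  "chain_A \<mu> es us m k = fst (run_from \<mu> es us m (nat (k + int m)))"

definition chain_B ::
  "'e::finite config pmf \<Rightarrow> (int \<Rightarrow> 'e) \<Rightarrow> (int \<Rightarrow> real) \<Rightarrow> nat \<Rightarrow> int \<Rightarrow> 'e config" where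
  "chain_B \<mu> es us m k = snd (run_from \<mu> es us m (nat (k + int m)))"

definition coalescence_time ::
  "'e::finite config pmf \<Rightarrow> (int \<Rightarrow> 'e) \<Rightarrow> (int \<Rightarrow> real) \<Rightarrow> enat" where
  "coalescence_time \<mu> es us =
     (if \<exists>m. chain_A \<mu> es us m 0 = chain_B \<mu> es us m 0
      then enat (LEAST m. chain_A \<mu> es us m 0 = chain_B \<mu> es us m 0)
      else \<infinity>)"

text \<open>\<open>A\<^sub>0(T)\<close>; on \<open>T = \<infinity>\<close> the value is an arbitrary \<open>A\<^sub>0(m)\<close>, since \<^term>\<open>the_enat \<infinity>\<close> is
  an unspecified natural number.\<close>

definition cftp_output ::
  "'e::finite config pmf \<Rightarrow> (int \<Rightarrow> 'e) \<Rightarrow> (int \<Rightarrow> real) \<Rightarrow> 'e config" where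
  "cftp_output \<mu> es us = chain_A \<mu> es us (the_enat (coalescence_time \<mu> es us)) 0"

end

theory Submission
  imports Defs
begin

text \<open>
  Run the heat-bath chain, with update probabilities \<^const>\<open>cond_open\<close> at every configuration, from
  an arbitrary initial state at time \<open>-m\<close> using the same \<open>(e\<^sub>n, U\<^sub>n)\<close>. It stays between \<open>A\<close> and \<open>B\<close>,
  so that as soon as \<open>m \<ge> T\<close> its state at time \<open>0\<close> is \<open>A\<^sub>0(T)\<close>, whatever the initial state. Since \<open>\<mu>\<close>
  is stationary for this chain, averaging over an initial state of law \<open>\<mu>\<close> shows that the law of
  \<open>A\<^sub>0(T)\<close> differs from \<open>\<mu>\<close> by at most \<open>P(T > m)\<close> at each point. For \<open>P(T > m) \<rightarrow> 0\<close>: as \<open>E\<close> is finite, \<^const>\<open>cond_open\<close>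
  is bounded below by some \<open>\<delta> > 0\<close>, and a block of \<open>|E|\<close> consecutive steps that visits all of \<open>E\<close> with
  all \<open>U \<le> \<delta>\<close> takes every ordered pair to \<open>(1, 1)\<close>. Disjoint blocks are independent and each is of this
  kind with the same positive probability.
\<close>

section \<open>Order off a site and bounds on the conditional probabilities\<close>

lemma le_off_refl: "le_off e \<xi> \<xi>"
  by (simp add: le_off_def)

lemma le_le_off: "\<xi> \<le> \<eta> \<Longrightarrow> le_off e \<xi> \<eta>"
  by (auto simp: le_off_def le_fun_def)

lemma le_off_upd [simp]:
  "le_off e (\<xi>(e := b)) \<psi> = le_off e \<xi> \<psi>" "le_off e \<xi> (\<psi>(e := b)) = le_off e \<xi> \<psi>"
  by (auto simp: le_off_def)

lemma cond_open_upd [simp]: "cond_open \<mu> e (\<psi>(e := b)) = cond_open \<mu> e \<psi>"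
  by (simp add: cond_open_def cond_usual_def)

lemma cond_open_cong_off:
  assumes "le_off e \<xi> \<psi>" "le_off e \<psi> \<xi>"
  shows "cond_open \<mu> e \<psi> = cond_open \<mu> e \<xi>"
proof -
  have "\<psi> = \<xi>(e := \<psi> e)"
    using assms by (auto simp: le_off_def fun_eq_iff)
  then show ?thesis
    by (metis cond_open_upd)
qed

lemma cond_open_bounds:
  assumes "le_off e \<xi> \<psi>" "le_off e \<psi> \<eta>"
  shows "lower_prob \<mu> e \<xi> \<eta> \<le> cond_open \<mu> e \<psi>"
    and "cond_open \<mu> e \<psi> \<le> upper_prob \<mu> e \<xi> \<eta>"
  unfolding lower_prob_def upper_prob_def using assms
  by (auto intro!: Min_le Max_ge)

text \<open>Between \<open>\<xi>\<close> and itself there is only one configuration off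
  \<open>e\<close>, so minimum and maximum coincide. This keeps the two chains together once they
  have met.\<close>

lemma lower_upper_prob_diag:
  "lower_prob \<mu> e \<xi> \<xi> = cond_open \<mu> e \<xi>" "upper_prob \<mu> e \<xi> \<xi> = cond_open \<mu> e \<xi>"
proof -
  have "{cond_open \<mu> e \<psi> |\<psi>. le_off e \<xi> \<psi> \<and> le_off e \<psi> \<xi>} = {cond_open \<mu> e \<xi>}"
    using cond_open_cong_off[of e \<xi>] le_off_refl[of e \<xi>] by blast
  then show "lower_prob \<mu> e \<xi> \<xi> = cond_open \<mu> e \<xi>" "upper_prob \<mu> e \<xi> \<xi> = cond_open \<mu> e \<xi>"
    by (simp_all add: lower_prob_def upper_prob_def)
qed

lemma cond_usual_pos:
  assumes "\<psi>(e := True) \<in> set_pmf \<mu>"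
  shows "0 < cond_usual \<mu> e \<psi>"
  using assms by (auto simp: cond_usual_def pmf_positive intro!: divide_pos_pos add_pos_nonneg)

lemma cond_usual_le_1: "cond_usual \<mu> e \<psi> \<le> 1"
  by (auto simp: cond_usual_def divide_le_eq_1 less_le)

text \<open>The maximum in the convention runs over a non-empty set, since the all-ones
  configuration dominates every \<open>\<xi>\<close> and lies in the support. Each candidate is a
  quotient with positive numerator, bounded by its denominator.\<close>

lemma cond_open_pos_le_1:
  assumes "(\<lambda>_. True) \<in> set_pmf \<mu>"
  shows "0 < cond_open \<mu> e \<xi>" and "cond_open \<mu> e \<xi> \<le> 1"
proof -
  let ?S = "{cond_usual \<mu> e \<psi> |\<psi>. le_off e \<xi> \<psi> \<and> \<psi>(e := True) \<in> set_pmf \<mu>}"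
  have "(\<lambda>_. True)(e := True) \<in> set_pmf \<mu>"
    using assms by (simp add: fun_upd_idem)
  then have "cond_usual \<mu> e (\<lambda>_. True) \<in> ?S"
    by (fastforce simp: le_off_def)
  then have "finite ?S" "?S \<noteq> {}"
    by auto
  then have "Max ?S \<in> ?S"
    by (rule Max_in)
  then have "0 < Max ?S" "Max ?S \<le> 1"
    using cond_usual_pos cond_usual_le_1 by auto
  then show "0 < cond_open \<mu> e \<xi>" "cond_open \<mu> e \<xi> \<le> 1"
    by (simp_all add: cond_open_def cond_usual_pos cond_usual_le_1)
qed

lemma cond_open_uniform_lower_bound:
  fixes \<mu> :: "'e::finite config pmf"
  assumes "(\<lambda>_. True) \<in> set_pmf \<mu>"
  obtains \<delta> where "0 < \<delta>" "\<delta> \<le> 1" "\<And>e \<xi>. \<delta> \<le> cond_open \<mu> e \<xi>"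
proof
  \<comment> \<open>There are finitely many sites and configurations, so the minimum exists and is
    positive. Inserting 1 secures \<open>\<delta> \<le> 1\<close>, so that
    \<open>U \<le> \<delta>\<close> has probability exactly \<open>\<delta>\<close>.\<close>
  let ?R = "insert 1 (range (\<lambda>(e, \<xi>). cond_open \<mu> e \<xi>))"
  show "0 < Min ?R"
    using cond_open_pos_le_1[OF assms] by auto
  show "Min ?R \<le> 1"
    by (rule Min_le) auto
  show "Min ?R \<le> cond_open \<mu> e \<xi>" for e \<xi>
    by (rule Min_le) auto
qed

text \<open>By \<open>\<xi> \<le> \<eta>\<close> the interval contains \<open>\<xi>\<close>: the
  minimum is attained by some configuration, and the maximum is at least the value at
  \<open>\<xi>\<close>.\<close>

lemma lower_upper_prob_ge:
  assumes "\<xi> \<le> \<eta>" and "\<And>\<psi>. \<delta> \<le> cond_open \<mu> e \<psi>"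
  shows "\<delta> \<le> lower_prob \<mu> e \<xi> \<eta>" and "\<delta> \<le> upper_prob \<mu> e \<xi> \<eta>"
proof -
  let ?S = "{cond_open \<mu> e \<psi> |\<psi>. le_off e \<xi> \<psi> \<and> le_off e \<psi> \<eta>}"
  have *: "le_off e \<xi> \<eta>"
    using assms(1) by (rule le_le_off)
  then have "cond_open \<mu> e \<xi> \<in> ?S"
    using le_off_refl[of e \<xi>] by blast
  moreover have "finite ?S"
    by simp
  ultimately have "Min ?S \<in> ?S"
    by (intro Min_in) auto
  then show "\<delta> \<le> lower_prob \<mu> e \<xi> \<eta>"
    unfolding lower_prob_def using assms(2) by fastforce
  show "\<delta> \<le> upper_prob \<mu> e \<xi> \<eta>"
    using assms(2) cond_open_bounds(2)[OF le_off_refl *] by (rule order_trans)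
qed

section \<open>Single-configuration dynamics, sandwiching and coalescence\<close>

text \<open>The heat-bath update of a single configuration, extended to configurations outside the
  support by the convention for \<^const>\<open>cond_open\<close>.\<close>

definition site_update :: "'e::finite config pmf \<Rightarrow> 'e \<Rightarrow> real \<Rightarrow> 'e config \<Rightarrow> 'e config" where
  "site_update \<mu> e u \<psi> = \<psi>(e := (u \<le> cond_open \<mu> e \<psi>))"

text \<open>Indexing runs by an explicit list of times, the head acting first, turns a split at an
  intermediate time into a list append.\<close>

definition run_site ::
  "'e::finite config pmf \<Rightarrow> (int \<Rightarrow> 'e) \<Rightarrow> (int \<Rightarrow> real) \<Rightarrow> int list \<Rightarrow> 'e config \<Rightarrow> 'e config" where
  "run_site \<mu> es us = fold (\<lambda>k. site_update \<mu> (es k) (us k))"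

definition run_pair ::
  "'e::finite config pmf \<Rightarrow> (int \<Rightarrow> 'e) \<Rightarrow> (int \<Rightarrow> real) \<Rightarrow> int list \<Rightarrow>
    'e config \<times> 'e config \<Rightarrow> 'e config \<times> 'e config" where
  "run_pair \<mu> es us = fold (\<lambda>k. update_pair \<mu> (es k) (us k))"

lemma run_site_simps [simp]:
  "run_site \<mu> es us [] x = x"
  "run_site \<mu> es us (k # l) x = run_site \<mu> es us l (site_update \<mu> (es k) (us k) x)"
  "run_site \<mu> es us (l @ l') x = run_site \<mu> es us l' (run_site \<mu> es us l x)"
  by (simp_all add: run_site_def)

lemma run_pair_simps [simp]:
  "run_pair \<mu> es us [] p = p"
  "run_pair \<mu> es us (k # l) p = run_pair \<mu> es us l (update_pair \<mu> (es k) (us k) p)"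
  "run_pair \<mu> es us (l @ l') p = run_pair \<mu> es us l' (run_pair \<mu> es us l p)"
  by (simp_all add: run_pair_def)

text \<open>This makes a run a function of the random source restricted to the listed times, as the
  independence argument requires.\<close>

lemma run_site_cong:
  assumes "\<And>k. k \<in> set l \<Longrightarrow> es k = es' k" "\<And>k. k \<in> set l \<Longrightarrow> us k = us' k"
  shows "run_site \<mu> es us l x = run_site \<mu> es' us' l x"
  unfolding run_site_def using assms by (intro fold_cong) auto

text \<open>The list starts at \<open>1 - int m\<close>: the initial pair sits at time
  \<open>- int m\<close>, and the first update uses the variables of the following time.\<close>

lemma run_from_eq_run_pair:
  "run_from \<mu> es us m j = run_pair \<mu> es us [1 - int m..int j - int m] (\<lambda>_. False, \<lambda>_. True)"
proof (induction j)
  case (Suc j)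
  have "[1 - int m..int (Suc j) - int m] = [1 - int m..int j - int m] @ [int (Suc j) - int m]"
    by (subst upto_rec2) (simp_all add: algebra_simps)
  with Suc show ?case
    by (simp add: Let_def)
qed simp

lemma chain_eq_run_pair:
  "chain_A \<mu> es us m 0 = fst (run_pair \<mu> es us [1 - int m..0] (\<lambda>_. False, \<lambda>_. True))"
  "chain_B \<mu> es us m 0 = snd (run_pair \<mu> es us [1 - int m..0] (\<lambda>_. False, \<lambda>_. True))"
  by (simp_all add: chain_A_def chain_B_def run_from_eq_run_pair)

text \<open>All three configurations use the same \<open>u\<close>, and the threshold of
  \<open>x\<close> lies between the minimum and the maximum over the interval. These extremes do the
  work that monotonicity of the conditional probability does in a monotone coupling.\<close>

lemma update_pair_sandwich:
  assumes "fst p \<le> x" "x \<le> snd p"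
  shows "fst (update_pair \<mu> e u p) \<le> site_update \<mu> e u x"
    and "site_update \<mu> e u x \<le> snd (update_pair \<mu> e u p)"
proof -
  obtain \<xi> \<eta> where p: "p = (\<xi>, \<eta>)"
    by (cases p)
  have "lower_prob \<mu> e \<xi> \<eta> \<le> cond_open \<mu> e x" "cond_open \<mu> e x \<le> upper_prob \<mu> e \<xi> \<eta>"
    using assms p by (auto intro!: cond_open_bounds le_le_off)
  then show "fst (update_pair \<mu> e u p) \<le> site_update \<mu> e u x"
    "site_update \<mu> e u x \<le> snd (update_pair \<mu> e u p)"
    using assms p by (auto simp: site_update_def le_fun_def)
qed

lemma run_pair_sandwich:
  assumes "fst p \<le> x" "x \<le> snd p"
  shows "fst (run_pair \<mu> es us l p) \<le> run_site \<mu> es us l x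
    \<and> run_site \<mu> es us l x \<le> snd (run_pair \<mu> es us l p)"
  using assms
proof (induction l arbitrary: p x)
  case (Cons k l)
  show ?case
    using Cons.IH[OF update_pair_sandwich[OF Cons.prems]] by simp
qed simp

lemma run_pair_diag: "run_pair \<mu> es us l (x, x) = (run_site \<mu> es us l x, run_site \<mu> es us l x)"
  by (induction l arbitrary: x) (simp_all add: lower_upper_prob_diag site_update_def)

text \<open>Every configuration lies between all zeros and all ones, so its run is squeezed between
  two equal ends.\<close>

lemma run_site_eq_coalesced:
  assumes "fst (run_pair \<mu> es us l (\<lambda>_. False, \<lambda>_. True)) =
    snd (run_pair \<mu> es us l (\<lambda>_. False, \<lambda>_. True))"
  shows "run_site \<mu> es us l x = fst (run_pair \<mu> es us l (\<lambda>_. False, \<lambda>_. True))"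
  using run_pair_sandwich[of "(\<lambda>_. False, \<lambda>_. True)" x \<mu> es us l] assms
  by (auto simp: le_fun_def fun_eq_iff)

text \<open>While \<open>U \<le> \<delta>\<close>, each update opens its site in the lower
  configuration whatever the other sites are, and no site is closed again. The disjunct
  \<open>fst p f\<close> carries already open sites through the induction.\<close>

lemma run_pair_opens_visited:
  assumes "\<And>e \<xi>. \<delta> \<le> cond_open \<mu> e \<xi>" "\<forall>k\<in>set l. us k \<le> \<delta>" "fst p \<le> snd p"
    and "f \<in> es ` set l \<or> fst p f"
  shows "fst (run_pair \<mu> es us l p) f"
  using assms(2-)
proof (induction l arbitrary: p)
  case (Cons k l)
  obtain \<xi> \<eta> where p: "p = (\<xi>, \<eta>)" "\<xi> \<le> \<eta>"
    using Cons.prems(2) by (cases p) auto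
  have \<delta>: "us k \<le> lower_prob \<mu> (es k) \<xi> \<eta>"
    using lower_upper_prob_ge(1)[OF p(2) assms(1)] Cons.prems(1)
    by (meson list.set_intros(1) order_trans)
  have "fst (update_pair \<mu> (es k) (us k) p) \<le> snd (update_pair \<mu> (es k) (us k) p)"
    using update_pair_sandwich[of p "fst p"] Cons.prems(2) order_trans by blast
  moreover have "f \<in> es ` set l \<or> fst (update_pair \<mu> (es k) (us k) p) f"
    using Cons.prems(3) p \<delta> by auto
  ultimately show ?case
    using Cons.IH Cons.prems(1) by simp
qed auto

text \<open>The middle block \<open>l2\<close> opens every site of the lower configuration, hence of
  the upper one too, whatever ordered pair \<open>l1\<close> has left. From the diagonal,
  \<open>l3\<close> cannot separate them.\<close>

lemma run_pair_coalesces: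
  assumes "\<And>e \<xi>. \<delta> \<le> cond_open \<mu> e \<xi>" "\<forall>k\<in>set l2. us k \<le> \<delta>" "es ` set l2 = UNIV"
  shows "fst (run_pair \<mu> es us (l1 @ l2 @ l3) (\<lambda>_. False, \<lambda>_. True)) =
    snd (run_pair \<mu> es us (l1 @ l2 @ l3) (\<lambda>_. False, \<lambda>_. True))"
proof -
  define p where "p = run_pair \<mu> es us l1 (\<lambda>_. False, \<lambda>_. True)"
  define q where "q = run_pair \<mu> es us l2 p"
  have p: "fst p \<le> snd p"
    unfolding p_def
    using run_pair_sandwich[of "(\<lambda>_. False, \<lambda>_. True)" "\<lambda>_. False" \<mu> es us l1]
    by (auto simp: le_fun_def)
  have "fst q f" for f
    unfolding q_def using run_pair_opens_visited[OF assms(1,2) p, of f es] assms(3) by simp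
  moreover have "fst q \<le> snd q"
    unfolding q_def using run_pair_sandwich[of p "fst p" \<mu> es us l2] p by (auto simp: le_fun_def)
  ultimately have "q = (\<lambda>_. True, \<lambda>_. True)"
    by (auto simp: prod_eq_iff le_fun_def fun_eq_iff)
  then have "run_pair \<mu> es us (l1 @ l2 @ l3) (\<lambda>_. False, \<lambda>_. True) =
      run_pair \<mu> es us l3 (\<lambda>_. True, \<lambda>_. True)"
    by (simp add: p_def q_def)
  then show ?thesis
    by (simp add: run_pair_diag)
qed

section \<open>Coalescence time and output along a sample path\<close>

lemma coalescence_time_finite_iff:
  "coalescence_time \<mu> es us < \<infinity> \<longleftrightarrow> (\<exists>m. chain_A \<mu> es us m 0 = chain_B \<mu> es us m 0)"
  by (simp add: coalescence_time_def)

text \<open>The steps after time \<open>-T\<close> are shared by all starting times. Whatever state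
  the earlier steps leave at time \<open>-T\<close>, the last \<open>T\<close> steps send it to the
  coalesced value.\<close>

lemma cftp_output_eq_run_site:
  assumes "chain_A \<mu> es us m0 0 = chain_B \<mu> es us m0 0" "m0 \<le> m"
  shows "run_site \<mu> es us [1 - int m..0] x = cftp_output \<mu> es us"
proof -
  define T where "T = (LEAST m. chain_A \<mu> es us m 0 = chain_B \<mu> es us m 0)"
  have T: "chain_A \<mu> es us T 0 = chain_B \<mu> es us T 0"
    unfolding T_def using assms(1) by (rule LeastI)
  have "T \<le> m"
    unfolding T_def using assms by (meson Least_le order_trans)
  \<comment> \<open>For \<open>T = m\<close> the first list is empty, which the splitting rule does
    not cover.\<close>
  then have "[1 - int m..0] = [1 - int m..- int T] @ [1 - int T..0]"
    using upto_split2[of "1 - int m" "- int T" 0] by (cases "T = m") (auto simp: algebra_simps)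
  then have "run_site \<mu> es us [1 - int m..0] x =
      run_site \<mu> es us [1 - int T..0] (run_site \<mu> es us [1 - int m..- int T] x)"
    by simp
  also have "\<dots> = chain_A \<mu> es us T 0"
    unfolding chain_eq_run_pair
    using T by (intro run_site_eq_coalesced) (simp add: chain_eq_run_pair)
  also have "\<dots> = cftp_output \<mu> es us"
    using assms(1) by (auto simp: cftp_output_def coalescence_time_def T_def)
  finally show ?thesis .
qed

section \<open>Stationarity of the one-site heat-bath kernel\<close>

text \<open>The bracket is the probability of moving from \<open>x\<close> to \<open>y\<close> when
  resampling at \<open>e\<close>. Only the two configurations agreeing with \<open>y\<close> off
  \<open>e\<close> can reach \<open>y\<close>, and their joint mass times the conditional
  probability of the value \<open>y e\<close> is the mass of \<open>y\<close>.\<close>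

lemma site_update_stationary:
  fixes \<mu> :: "'e::finite config pmf"
  assumes increasing: "\<And>\<omega> \<omega>'. \<omega> \<in> set_pmf \<mu> \<Longrightarrow> \<omega> \<le> \<omega>' \<Longrightarrow> \<omega>' \<in> set_pmf \<mu>"
  shows "(\<Sum>x\<in>UNIV. pmf \<mu> x *
      ((if x(e := True) = y then cond_open \<mu> e x else 0) +
       (if x(e := False) = y then 1 - cond_open \<mu> e x else 0))) = pmf \<mu> y"
    (is "(\<Sum>x\<in>UNIV. ?f x) = _")
proof -
  let ?y1 = "y(e := True)" and ?y0 = "y(e := False)"
  have ne: "?y1 \<noteq> ?y0"
    by (metis fun_upd_same)
  have "?f x = 0" if "x \<notin> {?y1, ?y0}" for x
  proof -
    have "x(e := b) \<noteq> y" for b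
      using that by (cases "x e") (auto simp: fun_upd_idem)
    then show ?thesis
      by simp
  qed
  then have "(\<Sum>x\<in>UNIV. ?f x) = (\<Sum>x\<in>{?y1, ?y0}. ?f x)"
    by (intro sum.mono_neutral_right) auto
  also have "\<dots> = (pmf \<mu> ?y1 + pmf \<mu> ?y0) *
      (if y e then cond_open \<mu> e y else 1 - cond_open \<mu> e y)"
    using ne by (auto simp: fun_upd_idem_iff algebra_simps)
  also have "\<dots> = pmf \<mu> y"
  proof (cases "?y1 \<in> set_pmf \<mu>")
    case True
    then have "pmf \<mu> ?y1 + pmf \<mu> ?y0 > 0"
      by (simp add: pmf_positive add_pos_nonneg)
    then have "(pmf \<mu> ?y1 + pmf \<mu> ?y0) * cond_open \<mu> e y = pmf \<mu> ?y1"
      using True by (simp add: cond_open_def cond_usual_def)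
    then show ?thesis
      by (cases "y e") (auto simp: fun_upd_idem algebra_simps)
  next
    case False
    \<comment> \<open>This is where the support being increasing enters: if the open version has
      mass zero, so has the closed one, and both sides vanish.\<close>
    have "?y0 \<le> ?y1"
      by (simp add: le_fun_def)
    then have "pmf \<mu> ?y1 = 0" "pmf \<mu> ?y0 = 0"
      using False increasing by (auto simp: set_pmf_iff)
    moreover from this have "pmf \<mu> y = 0"
      by (cases "y e") (auto simp: fun_upd_idem)
    ultimately show ?thesis
      by simp
  qed
  finally show ?thesis .
qed

section \<open>Measurability of runs driven by random variables\<close>

text \<open>The intermediate state takes countably many values, so it can be fixed one value at a
  time. It then suffices that each step is measurable from a fixed state.\<close>

lemma measurable_fold_countable:
  fixes s :: "'s::countable"
  assumes "\<And>k s. k \<in> set l \<Longrightarrow> (\<lambda>x. f k x s) \<in> N \<rightarrow>\<^sub>M count_space UNIV"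
  shows "(\<lambda>x. fold (\<lambda>k. f k x) l s) \<in> N \<rightarrow>\<^sub>M count_space UNIV"
  using assms
proof (induction l rule: rev_induct)
  case (snoc k l)
  have "(\<lambda>x. f k x (fold (\<lambda>k. f k x) l s)) \<in> N \<rightarrow>\<^sub>M count_space UNIV"
  proof (rule measurable_compose_countable'[where I = UNIV and f = "\<lambda>s x. f k x s"])
    show "(\<lambda>x. f k x s) \<in> N \<rightarrow>\<^sub>M count_space UNIV" for s
      by (rule snoc.prems) simp
    show "(\<lambda>x. fold (\<lambda>k. f k x) l s) \<in> N \<rightarrow>\<^sub>M count_space UNIV"
      by (rule snoc.IH, rule snoc.prems) simp
  qed simp
  then show ?case
    by simp
qed simp

lemma measurable_site_update:
  fixes \<mu> :: "'e::finite config pmf"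
  assumes "es \<in> N \<rightarrow>\<^sub>M count_space UNIV" "us \<in> borel_measurable N"
  shows "(\<lambda>x. site_update \<mu> (es x) (us x) \<psi>) \<in> N \<rightarrow>\<^sub>M count_space UNIV"
proof (rule measurable_compose_countable'[where I = UNIV and g = es])
  show "(\<lambda>x. site_update \<mu> a (us x) \<psi>) \<in> N \<rightarrow>\<^sub>M count_space UNIV" for a
  proof -
    have "(\<lambda>x. if us x \<le> cond_open \<mu> a \<psi> then \<psi>(a := True) else \<psi>(a := False))
        \<in> N \<rightarrow>\<^sub>M count_space UNIV"
      using assms(2) by measurable
    also have "(\<lambda>x. if us x \<le> cond_open \<mu> a \<psi> then \<psi>(a := True) else \<psi>(a := False)) =
        (\<lambda>x. site_update \<mu> a (us x) \<psi>)"
      by (auto simp: site_update_def fun_eq_iff)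
    finally show ?thesis .
  qed
qed (use assms in auto)

lemma measurable_update_pair:
  fixes \<mu> :: "'e::finite config pmf"
  assumes "es \<in> N \<rightarrow>\<^sub>M count_space UNIV" "us \<in> borel_measurable N"
  shows "(\<lambda>x. update_pair \<mu> (es x) (us x) p) \<in> N \<rightarrow>\<^sub>M count_space UNIV"
proof (rule measurable_compose_countable'[where I = UNIV and g = es])
  obtain \<xi> \<eta> where p: "p = (\<xi>, \<eta>)"
    by (cases p)
  show "(\<lambda>x. update_pair \<mu> a (us x) p) \<in> N \<rightarrow>\<^sub>M count_space UNIV" for a
  proof -
    \<comment> \<open>With site and pair fixed, the update is a choice among four constants decided
      by comparing \<open>us x\<close> with two numbers.\<close>
    have "(\<lambda>x. if us x \<le> lower_prob \<mu> a \<xi> \<eta>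
          then if us x \<le> upper_prob \<mu> a \<xi> \<eta> then (\<xi>(a := True), \<eta>(a := True))
            else (\<xi>(a := True), \<eta>(a := False))
          else if us x \<le> upper_prob \<mu> a \<xi> \<eta> then (\<xi>(a := False), \<eta>(a := True))
            else (\<xi>(a := False), \<eta>(a := False)))
        \<in> N \<rightarrow>\<^sub>M count_space UNIV" (is "?f \<in> _")
      using assms(2) by measurable
    also have "?f = (\<lambda>x. update_pair \<mu> a (us x) p)"
      by (auto simp: p fun_eq_iff)
    finally show ?thesis .
  qed
qed (use assms in auto)

section \<open>The random source and the law of one update\<close>

text \<open>Independence comes in two layers: between the pairs at different times, and between site
  and threshold at one time. Together they give joint independence of all the variables at
  non-positive times.\<close>

locale cftp_source = prob_space M for M :: "'w measure" +
  fixes e :: "int \<Rightarrow> 'w \<Rightarrow> 'e::finite" and U :: "int \<Rightarrow> 'w \<Rightarrow> real"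
  assumes indep_pairs: "indep_vars (\<lambda>_. count_space UNIV \<Otimes>\<^sub>M borel) (\<lambda>n x. (e n x, U n x)) {..0}"
    and indep_within: "\<And>n. n \<le> 0 \<Longrightarrow>
           indep_set
             {e n -` C \<inter> space M |C. C \<in> sets (count_space UNIV)}
             {U n -` D \<inter> space M |D. D \<in> sets borel}"
    and unif_e: "\<And>n. n \<le> 0 \<Longrightarrow>
           distr M (count_space UNIV) (e n) = uniform_count_measure UNIV"
    and unif_U: "\<And>n. n \<le> 0 \<Longrightarrow> distr M borel (U n) = uniform_measure lborel {0..1}"
begin

lemma measurable_pair: "n \<le> 0 \<Longrightarrow> (\<lambda>x. (e n x, U n x)) \<in> M \<rightarrow>\<^sub>M count_space UNIV \<Otimes>\<^sub>M borel"
  using indep_pairs by (auto simp: indep_vars_def)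

lemma measurable_e: "n \<le> 0 \<Longrightarrow> e n \<in> M \<rightarrow>\<^sub>M count_space UNIV"
  using measurable_compose[OF measurable_pair measurable_fst] by simp

lemma measurable_U: "n \<le> 0 \<Longrightarrow> U n \<in> borel_measurable M"
  using measurable_compose[OF measurable_pair measurable_snd] by simp

lemma prob_e:
  assumes "n \<le> 0"
  shows "prob (e n -` {a} \<inter> space M) = 1 / CARD('e)"
proof -
  have "prob (e n -` {a} \<inter> space M) = measure (distr M (count_space UNIV) (e n)) {a}"
    using measurable_e[OF assms] by (subst measure_distr) auto
  also have "\<dots> = 1 / CARD('e)"
    unfolding unif_e[OF assms] by (subst measure_uniform_count_measure) auto
  finally show ?thesis .
qed

lemma prob_U_le:
  assumes "n \<le> 0" "0 \<le> c" "c \<le> 1"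
  shows "prob (U n -` {..c} \<inter> space M) = c"
proof -
  have "prob (U n -` {..c} \<inter> space M) = measure (distr M borel (U n)) {..c}"
    using measurable_U[OF assms(1)] by (subst measure_distr) auto
  also have "\<dots> = measure lborel ({0..1} \<inter> {..c})"
    unfolding unif_U[OF assms(1)] by (subst measure_uniform_measure) auto
  also have "{0..1} \<inter> {..c} = {0..c}"
    using assms by auto
  finally show ?thesis
    using assms by simp
qed

lemma prob_e_U:
  assumes "n \<le> 0" "D \<in> sets borel"
  shows "prob {x \<in> space M. e n x = a \<and> U n x \<in> D} = prob (U n -` D \<inter> space M) / CARD('e)"
proof -
  have "{x \<in> space M. e n x = a \<and> U n x \<in> D} =
      (e n -` {a} \<inter> space M) \<inter> (U n -` D \<inter> space M)"
    by auto
  also have "prob \<dots> = prob (e n -` {a} \<inter> space M) * prob (U n -` D \<inter> space M)"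
    using assms by (intro indep_setD[OF indep_within[OF assms(1)]]) auto
  finally show ?thesis
    using prob_e[OF assms(1)] by simp
qed

text \<open>Conditioning on the uniformly chosen site \<open>a\<close> leaves an event for the
  threshold alone. The summand is the weight appearing in
  \<open>site_update_stationary\<close>.\<close>

lemma prob_site_update:
  assumes "n \<le> 0" "(\<lambda>_. True) \<in> set_pmf \<mu>"
  shows "prob {x \<in> space M. site_update \<mu> (e n x) (U n x) \<psi> = y} =
    (\<Sum>a\<in>UNIV. (if \<psi>(a := True) = y then cond_open \<mu> a \<psi> else 0) +
       (if \<psi>(a := False) = y then 1 - cond_open \<mu> a \<psi> else 0)) / CARD('e)"
proof -
  let ?D = "\<lambda>a. {u. site_update \<mu> a u \<psi> = y}"
  have D: "?D a \<in> sets borel \<and> prob (U n -` ?D a \<inter> space M) =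
      (if \<psi>(a := True) = y then cond_open \<mu> a \<psi> else 0) +
      (if \<psi>(a := False) = y then 1 - cond_open \<mu> a \<psi> else 0)" for a
  proof -
    let ?c = "cond_open \<mu> a \<psi>"
    have c: "prob (U n -` {..?c} \<inter> space M) = ?c"
      using cond_open_pos_le_1[OF assms(2), of a \<psi>] by (intro prob_U_le[OF assms(1)]) auto
    have "U n -` {?c<..} \<inter> space M = space M - (U n -` {..?c} \<inter> space M)"
      by auto
    moreover have "prob (space M - (U n -` {..?c} \<inter> space M)) = 1 - ?c"
      using measurable_U[OF assms(1)] c by (subst prob_compl) auto
    ultimately have c': "prob (U n -` {?c<..} \<inter> space M) = 1 - ?c"
      by simp
    \<comment> \<open>The two resampled configurations differ at \<open>a\<close>, so they cannot
      both equal \<open>y\<close>.\<close>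
    consider "\<psi>(a := True) = y" "\<psi>(a := False) \<noteq> y" | "\<psi>(a := True) \<noteq> y" "\<psi>(a := False) = y"
      | "\<psi>(a := True) \<noteq> y" "\<psi>(a := False) \<noteq> y"
      by (metis fun_upd_same)
    then show ?thesis
    proof cases
      case 1
      then have "?D a = {..?c}"
        by (auto simp: site_update_def)
      with 1 c show ?thesis by simp
    next
      case 2
      then have "?D a = {?c<..}"
        by (auto simp: site_update_def not_le[symmetric])
      with 2 c' show ?thesis by simp
    next
      case 3
      have "site_update \<mu> a u \<psi> \<noteq> y" for u
        using 3 by (cases "u \<le> ?c") (simp_all add: site_update_def)
      then have "?D a = {}"
        by simp
      with 3 show ?thesis by simp
    qed
  qed
  have "{x \<in> space M. site_update \<mu> (e n x) (U n x) \<psi> = y} =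
      (\<Union>a\<in>UNIV. {x \<in> space M. e n x = a \<and> U n x \<in> ?D a})"
    by auto
  also have "prob \<dots> = (\<Sum>a\<in>UNIV. prob {x \<in> space M. e n x = a \<and> U n x \<in> ?D a})"
  proof (rule finite_measure_finite_Union)
    show "(\<lambda>a. {x \<in> space M. e n x = a \<and> U n x \<in> ?D a}) ` UNIV \<subseteq> events"
    proof safe
      fix a
      have "(e n -` {a} \<inter> space M) \<inter> (U n -` ?D a \<inter> space M) \<in> events"
        using measurable_e[OF assms(1)] measurable_U[OF assms(1)] D
        by (intro sets.Int measurable_sets) auto
      also have "(e n -` {a} \<inter> space M) \<inter> (U n -` ?D a \<inter> space M) =
          {x \<in> space M. e n x = a \<and> U n x \<in> ?D a}"
        by auto
      finally show "{x \<in> space M. e n x = a \<and> U n x \<in> ?D a} \<in> events" .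
    qed
  qed (auto simp: disjoint_family_on_def)
  also have "\<dots> = (\<Sum>a\<in>UNIV. prob (U n -` ?D a \<inter> space M) / CARD('e))"
    using D by (intro sum.cong prob_e_U[OF assms(1)]) auto
  finally show ?thesis
    using D by (simp add: sum_divide_distrib)
qed

text \<open>The random update is the uniform mixture over sites of kernels that each preserve
  \<open>\<mu>\<close>.\<close>

lemma site_update_preserves:
  fixes \<mu> :: "'e config pmf"
  assumes increasing: "\<And>\<omega> \<omega>'. \<omega> \<in> set_pmf \<mu> \<Longrightarrow> \<omega> \<le> \<omega>' \<Longrightarrow> \<omega>' \<in> set_pmf \<mu>"
    and top: "(\<lambda>_. True) \<in> set_pmf \<mu>" and "n \<le> 0"
  shows "(\<Sum>x\<in>UNIV. pmf \<mu> x * prob {w \<in> space M. site_update \<mu> (e n w) (U n w) x = y}) = pmf \<mu> y"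
proof -
  have "(\<Sum>x\<in>UNIV. pmf \<mu> x * prob {w \<in> space M. site_update \<mu> (e n w) (U n w) x = y}) =
      (\<Sum>x\<in>UNIV. \<Sum>a\<in>UNIV. pmf \<mu> x *
        ((if x(a := True) = y then cond_open \<mu> a x else 0) +
         (if x(a := False) = y then 1 - cond_open \<mu> a x else 0))) / CARD('e)"
    by (simp add: prob_site_update[OF assms(3) top] sum_divide_distrib sum_distrib_left)
  also have "\<dots> = (\<Sum>a\<in>(UNIV::'e set). pmf \<mu> y) / CARD('e)"
    by (subst sum.swap) (simp add: site_update_stationary[OF increasing])
  finally show ?thesis
    by simp
qed

section \<open>Law of the single-configuration run\<close>

lemma measurable_run_site:
  assumes "\<And>k. k \<in> set l \<Longrightarrow> k \<le> 0"
  shows "(\<lambda>w. run_site \<mu> (\<lambda>n. e n w) (\<lambda>n. U n w) l x) \<in> M \<rightarrow>\<^sub>M count_space UNIV"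
  unfolding run_site_def using assms
  by (intro measurable_fold_countable measurable_site_update measurable_e measurable_U) auto

lemma measurable_run_pair:
  assumes "\<And>k. k \<in> set l \<Longrightarrow> k \<le> 0"
  shows "(\<lambda>w. run_pair \<mu> (\<lambda>n. e n w) (\<lambda>n. U n w) l p) \<in> M \<rightarrow>\<^sub>M count_space UNIV"
  unfolding run_pair_def using assms
  by (intro measurable_fold_countable measurable_update_pair measurable_e measurable_U) auto

text \<open>The step reads only time \<open>n\<close> and the run only times in
  \<open>{i..0}\<close>. These index sets are disjoint, so functions of the two restrictions of the
  source are independent.\<close>

lemma indep_site_update_run_site:
  assumes "n < i" "i \<le> 0"
  shows "prob {w \<in> space M. site_update \<mu> (e n w) (U n w) x = z \<and>
      run_site \<mu> (\<lambda>k. e k w) (\<lambda>k. U k w) [i..0] z' = y} =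
    prob {w \<in> space M. site_update \<mu> (e n w) (U n w) x = z} *
    prob {w \<in> space M. run_site \<mu> (\<lambda>k. e k w) (\<lambda>k. U k w) [i..0] z' = y}"
proof -
  let ?N = "\<lambda>_. count_space UNIV \<Otimes>\<^sub>M borel :: ('e \<times> real) measure"
  let ?X = "\<lambda>A w. restrict (\<lambda>k. (e k w, U k w)) A"
  let ?f = "\<lambda>v. site_update \<mu> (fst (v n)) (snd (v n)) x"
  let ?g = "\<lambda>v. run_site \<mu> (\<lambda>k. fst (v k)) (\<lambda>k. snd (v k)) [i..0] z'"
  have fst: "(\<lambda>v. fst (v k)) \<in> PiM A ?N \<rightarrow>\<^sub>M count_space UNIV"
    and snd: "(\<lambda>v. snd (v k)) \<in> borel_measurable (PiM A ?N)" if "k \<in> A" for k and A :: "int set"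
    using measurable_compose[OF measurable_component_singleton[OF that, of ?N]] by auto
  have "indep_var (PiM {n} ?N) (?X {n}) (PiM {i..0} ?N) (?X {i..0})"
    using assms by (intro indep_var_restrict[OF indep_pairs]) auto
  then have "indep_var (count_space UNIV) (?f \<circ> ?X {n}) (count_space UNIV) (?g \<circ> ?X {i..0})"
  proof (rule indep_var_compose)
    show "?f \<in> PiM {n} ?N \<rightarrow>\<^sub>M count_space UNIV"
      by (intro measurable_site_update fst snd) auto
    show "?g \<in> PiM {i..0} ?N \<rightarrow>\<^sub>M count_space UNIV"
      unfolding run_site_def
      by (intro measurable_fold_countable measurable_site_update fst snd) auto
  qed
  then have "\<P>(w in M. (?f \<circ> ?X {n}) w \<in> {z} \<and> (?g \<circ> ?X {i..0}) w \<in> {y}) =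
      \<P>(w in M. (?f \<circ> ?X {n}) w \<in> {z}) * \<P>(w in M. (?g \<circ> ?X {i..0}) w \<in> {y})"
    by (rule prob_indep_random_variable) auto
  moreover have "(?g \<circ> ?X {i..0}) w = run_site \<mu> (\<lambda>k. e k w) (\<lambda>k. U k w) [i..0] z'" for w
    by (auto intro!: run_site_cong)
  ultimately show ?thesis
    by simp
qed

text \<open>Induction prepends the earliest step. That step is independent of the rest of the run,
  so summing over the state \<open>z\<close> it produces composes a kernel preserving
  \<open>\<mu>\<close> with the shorter run.\<close>

lemma run_site_preserves:
  fixes \<mu> :: "'e config pmf"
  assumes increasing: "\<And>\<omega> \<omega>'. \<omega> \<in> set_pmf \<mu> \<Longrightarrow> \<omega> \<le> \<omega>' \<Longrightarrow> \<omega>' \<in> set_pmf \<mu>"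
    and top: "(\<lambda>_. True) \<in> set_pmf \<mu>"
  shows "(\<Sum>x\<in>UNIV. pmf \<mu> x *
    prob {w \<in> space M. run_site \<mu> (\<lambda>k. e k w) (\<lambda>k. U k w) [1 - int m..0] x = y}) = pmf \<mu> y"
proof (induction m)
  case 0
  have "prob {w \<in> space M. x = y} = (if x = y then 1 else 0)" for x
    by (simp add: prob_space)
  then show ?case
    by (simp add: if_distrib[of "(*) _"] cong: if_cong)
next
  case (Suc m)
  let ?run = "\<lambda>m x w. run_site \<mu> (\<lambda>k. e k w) (\<lambda>k. U k w) [1 - int m..0] x"
  let ?step = "\<lambda>x w. site_update \<mu> (e (- int m) w) (U (- int m) w) x"
  have run: "?run (Suc m) x w = ?run m (?step x w) w" for x w
    by (simp add: upto_rec1)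
  have *: "prob {w \<in> space M. ?run (Suc m) x w = y} =
      (\<Sum>z\<in>UNIV. prob {w \<in> space M. ?step x w = z} * prob {w \<in> space M. ?run m z w = y})" for x
  proof -
    have "{w \<in> space M. ?run (Suc m) x w = y} =
        (\<Union>z\<in>UNIV. {w \<in> space M. ?step x w = z \<and> ?run m z w = y})"
      unfolding run by auto
    also have "prob \<dots> = (\<Sum>z\<in>UNIV. prob {w \<in> space M. ?step x w = z \<and> ?run m z w = y})"
    proof (rule finite_measure_finite_Union)
      have "{w \<in> space M. ?step x w = z \<and> ?run m z w = y} \<in> events" for z
      proof -
        have "?step x -` {z} \<inter> space M \<in> events"
          by (rule measurable_sets[OF measurable_site_update[OF measurable_e measurable_U]]) auto
        moreover have "?run m z -` {y} \<inter> space M \<in> events"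
          by (rule measurable_sets[OF measurable_run_site]) auto
        ultimately have "(?step x -` {z} \<inter> space M) \<inter> (?run m z -` {y} \<inter> space M) \<in> events"
          by (rule sets.Int)
        also have "(?step x -` {z} \<inter> space M) \<inter> (?run m z -` {y} \<inter> space M) =
            {w \<in> space M. ?step x w = z \<and> ?run m z w = y}"
          by auto
        finally show ?thesis .
      qed
      then show "(\<lambda>z. {w \<in> space M. ?step x w = z \<and> ?run m z w = y}) ` UNIV \<subseteq> events"
        by auto
    qed (auto simp: disjoint_family_on_def)
    also have "\<dots> = (\<Sum>z\<in>UNIV. prob {w \<in> space M. ?step x w = z} *
        prob {w \<in> space M. ?run m z w = y})"
    proof (cases m)
      \<comment> \<open>Here the remaining list \<open>[1..0]\<close> is empty and the run is the
        identity, so the factorisation is checked directly.\<close>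
      case 0
      then show ?thesis
        by (intro sum.cong refl, rename_tac z, case_tac "z = y") (auto simp: prob_space)
    next
      case (Suc m')
      then show ?thesis
        by (intro sum.cong indep_site_update_run_site) auto
    qed
    finally show ?thesis .
  qed
  have "(\<Sum>x\<in>UNIV. pmf \<mu> x * prob {w \<in> space M. ?run (Suc m) x w = y}) =
      (\<Sum>z\<in>UNIV. (\<Sum>x\<in>UNIV. pmf \<mu> x * prob {w \<in> space M. ?step x w = z}) *
        prob {w \<in> space M. ?run m z w = y})"
    unfolding * sum_distrib_left sum_distrib_right by (subst sum.swap) (simp add: mult.assoc)
  also have "\<dots> = (\<Sum>z\<in>UNIV. pmf \<mu> z * prob {w \<in> space M. ?run m z w = y})"
    by (simp add: site_update_preserves[OF increasing top])
  also have "\<dots> = pmf \<mu> y"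
    by (rule Suc.IH)
  finally show ?case .
qed

section \<open>Independent blocks that force coalescence\<close>

text \<open>Block \<open>j\<close> consists of the times \<open>- int (j * N + i)\<close> with
  \<open>i < N\<close>. Prescribing the visiting order \<open>h\<close> makes \<open>G j\<close> an
  intersection of \<open>N\<close> independent events of probability
  \<open>\<delta> / CARD('e)\<close> each; distinct blocks use disjoint times.\<close>

lemma prob_no_full_block:
  assumes "0 < \<delta>" "\<delta> \<le> 1" and h: "bij_betw h {..<N} (UNIV :: 'e set)"
  defines "G \<equiv> \<lambda>j w. \<forall>i<N. e (- int (j * N + i)) w = h i \<and> U (- int (j * N + i)) w \<le> \<delta>"
  shows "{w \<in> space M. \<forall>j<J. \<not> G j w} \<in> events"
    and "prob {w \<in> space M. \<forall>j<J. \<not> G j w} = (1 - (\<delta> / CARD('e)) ^ N) ^ J"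
proof -
  define K where "K j = (\<lambda>i. - int (j * N + i)) ` {..<N}" for j
  let ?N = "\<lambda>_. count_space UNIV \<Otimes>\<^sub>M borel :: ('e \<times> real) measure"
  let ?X = "\<lambda>j w. restrict (\<lambda>k. (e k w, U k w)) (K j)"
  let ?Y = "\<lambda>j v. \<forall>i<N. v (- int (j * N + i)) \<in> {h i} \<times> {..\<delta>}"
  have N: "0 < N"
    using h by (cases N) (auto simp: bij_betw_def)
  have G: "?Y j (?X j w) = G j w" for j w
    by (auto simp: G_def K_def)
  have K_le: "K j \<subseteq> {..0}" for j
    by (auto simp: K_def simp del: of_nat_add of_nat_mult)
  have "K i \<inter> K j = {}" if "i \<noteq> j" for i j
  proof -
    have "i * N + a \<noteq> j * N + b" if "a < N" "b < N" for a b
    proof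
      assume "i * N + a = j * N + b"
      \<comment> \<open>Dividing by \<open>N\<close> recovers the block index from a time.\<close>
      then have "(i * N + a) div N = (j * N + b) div N"
        by simp
      with that \<open>i \<noteq> j\<close> show False
        by simp
    qed
    then show ?thesis
      unfolding K_def by (auto simp del: of_nat_add of_nat_mult)
  qed
  then have disj: "disjoint_family_on K UNIV"
    by (auto simp: disjoint_family_on_def)
  have "indep_vars (\<lambda>_. count_space UNIV) (\<lambda>j w. ?Y j (?X j w)) UNIV"
  proof (rule indep_vars_compose2[OF indep_vars_restrict[OF indep_pairs K_le disj]])
    show "?Y j \<in> PiM (K j) ?N \<rightarrow>\<^sub>M count_space UNIV" for j
    proof -
      have "Measurable.pred (PiM (K j) ?N) (\<lambda>v. v (- int (j * N + i)) \<in> {h i} \<times> {..\<delta>})"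
        if "i < N" for i
        using that
        by (intro pred_sets2[where N = "count_space UNIV \<Otimes>\<^sub>M borel"] measurable_component_singleton)
          (auto simp: K_def)
      then show ?thesis
        by (intro pred_intros_countable pred_intros_imp')
    qed
  qed
  then have indep: "indep_vars (\<lambda>_. count_space UNIV) G UNIV"
    unfolding G .
  have prob_G: "prob (G j -` {True} \<inter> space M) = (\<delta> / CARD('e)) ^ N" for j
  proof -
    \<comment> \<open>For \<open>k = - int (j * N + i)\<close> the expression
      \<open>nat (- k) - j * N\<close> gives back the offset \<open>i\<close>.\<close>
    let ?D = "\<lambda>k. {h (nat (- k) - j * N)} \<times> {..\<delta>}"
    have ne: "K j \<noteq> {}"
      using N by (auto simp: K_def)
    have "G j -` {True} \<inter> space M = (\<Inter>k\<in>K j. (\<lambda>w. (e k w, U k w)) -` ?D k \<inter> space M)"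
      using ne by (auto simp: G_def K_def simp del: of_nat_add of_nat_mult)
    also have "prob \<dots> = (\<Prod>k\<in>K j. prob ((\<lambda>w. (e k w, U k w)) -` ?D k \<inter> space M))"
      using ne K_le by (intro indep_varsD[OF indep_pairs]) (auto simp: K_def)
    also have "\<dots> = (\<Prod>k\<in>K j. \<delta> / CARD('e))"
    proof (rule prod.cong[OF refl])
      fix k assume "k \<in> K j"
      then have k: "k \<le> 0"
        using K_le by auto
      have "(\<lambda>w. (e k w, U k w)) -` ?D k \<inter> space M =
          {w \<in> space M. e k w = h (nat (- k) - j * N) \<and> U k w \<in> {..\<delta>}}"
        by auto
      then show "prob ((\<lambda>w. (e k w, U k w)) -` ?D k \<inter> space M) = \<delta> / CARD('e)"
        using prob_e_U[OF k, of "{..\<delta>}"] prob_U_le[OF k, of \<delta>] assms by simp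
    qed
    also have "\<dots> = (\<delta> / CARD('e)) ^ N"
      by (simp add: K_def card_image inj_on_def)
    finally show ?thesis .
  qed
  have meas: "G j \<in> M \<rightarrow>\<^sub>M count_space UNIV" for j
    using indep by (auto simp: indep_vars_def)
  have prob_not_G: "prob (G j -` {False} \<inter> space M) = 1 - (\<delta> / CARD('e)) ^ N" for j
  proof -
    have "G j -` {False} \<inter> space M = space M - (G j -` {True} \<inter> space M)"
      by auto
    then show ?thesis
      using prob_compl[OF measurable_sets[OF meas, of "{True}" j]] prob_G by simp
  qed
  have "{w \<in> space M. \<forall>j<J. \<not> G j w} \<in> events \<and>
      prob {w \<in> space M. \<forall>j<J. \<not> G j w} = (1 - (\<delta> / CARD('e)) ^ N) ^ J"
  \<comment> \<open>The product formula needs a non-empty index set; for \<open>J = 0\<close> the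
    event is the whole space.\<close>
  proof (cases "J = 0")
    case False
    have "{w \<in> space M. \<forall>j<J. \<not> G j w} = (\<Inter>j\<in>{..<J}. G j -` {False} \<inter> space M)"
      using False by auto
    moreover have "(\<Inter>j\<in>{..<J}. G j -` {False} \<inter> space M) \<in> events"
      using False meas by (intro sets.finite_INT measurable_sets) auto
    moreover have "prob (\<Inter>j\<in>{..<J}. G j -` {False} \<inter> space M) =
        (\<Prod>j\<in>{..<J}. prob (G j -` {False} \<inter> space M))"
      using False by (intro indep_varsD[OF indep]) auto
    ultimately show ?thesis
      by (simp add: prob_not_G)
  qed (simp add: prob_space)
  then show "{w \<in> space M. \<forall>j<J. \<not> G j w} \<in> events"
    "prob {w \<in> space M. \<forall>j<J. \<not> G j w} = (1 - (\<delta> / CARD('e)) ^ N) ^ J"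
    by blast+
qed

text \<open>Started at time \<open>- int (Suc j * N)\<close>, the chain meets block \<open>j\<close>
  as its first \<open>N\<close> updates, and \<open>h\<close> is onto, so the block visits every
  site.\<close>

lemma chain_coalesces_in_block:
  assumes \<delta>: "\<And>a \<xi>. \<delta> \<le> cond_open \<mu> a \<xi>" and h: "bij_betw h {..<N} (UNIV :: 'e set)"
    and G: "\<forall>i<N. es (- int (j * N + i)) = h i \<and> us (- int (j * N + i)) \<le> \<delta>"
  shows "chain_A \<mu> es us (Suc j * N) 0 = chain_B \<mu> es us (Suc j * N) 0"
proof -
  let ?block = "[1 - int (Suc j * N)..- int (j * N)]"
  have "0 < N"
    using h by (cases N) (auto simp: bij_betw_def)
  then have split: "[1 - int (Suc j * N)..0] = [] @ ?block @ [1 - int (j * N)..0]"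
    using upto_split2[of "1 - int (Suc j * N)" "- int (j * N)" 0] by (simp add: algebra_simps)
  have us: "\<forall>k\<in>set ?block. us k \<le> \<delta>"
  proof
    fix k assume k: "k \<in> set ?block"
    define i where "i = nat (- k - int (j * N))"
    have "i < N" "k = - int (j * N + i)"
      using k by (auto simp: i_def)
    with G show "us k \<le> \<delta>"
      by metis
  qed
  have "f \<in> es ` set ?block" for f
  proof -
    have "f \<in> h ` {..<N}"
      using h by (simp add: bij_betw_def)
    then obtain i where "i < N" "h i = f"
      by blast
    with G have "es (- int (j * N + i)) = f" "- int (j * N + i) \<in> set ?block"
      by auto
    then show ?thesis
      by blast
  qed
  then have "es ` set ?block = UNIV"
    by blast
  from run_pair_coalesces[OF \<delta> us this] show ?thesis
    unfolding chain_eq_run_pair split .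
qed

section \<open>Measurability of the coalescence time and the output\<close>

lemma measurable_chain:
  "(\<lambda>w. chain_A \<mu> (\<lambda>n. e n w) (\<lambda>n. U n w) m 0) \<in> M \<rightarrow>\<^sub>M count_space UNIV"
  "(\<lambda>w. chain_B \<mu> (\<lambda>n. e n w) (\<lambda>n. U n w) m 0) \<in> M \<rightarrow>\<^sub>M count_space UNIV"
  unfolding chain_eq_run_pair
  by (rule measurable_compose[OF measurable_run_pair], auto)+

lemma pred_coalesced:
  "Measurable.pred M (\<lambda>w. chain_A \<mu> (\<lambda>n. e n w) (\<lambda>n. U n w) m 0 =
     chain_B \<mu> (\<lambda>n. e n w) (\<lambda>n. U n w) m 0)"
  using measurable_chain[of \<mu> m] by measurable

text \<open>The coalescence time is a least index with a measurable property, and the output selects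
  among countably many measurable chains according to its value.\<close>

lemma measurable_cftp_output:
  "(\<lambda>w. cftp_output \<mu> (\<lambda>n. e n w) (\<lambda>n. U n w)) \<in> M \<rightarrow>\<^sub>M count_space UNIV"
proof -
  have T: "(\<lambda>w. coalescence_time \<mu> (\<lambda>n. e n w) (\<lambda>n. U n w)) \<in> M \<rightarrow>\<^sub>M count_space UNIV"
    unfolding coalescence_time_def
    by (intro measurable_If measurable_compose[OF measurable_Least, where g = enat]
        predE pred_intros_countable pred_coalesced) auto
  show ?thesis
    unfolding cftp_output_def
    by (rule measurable_compose_countable'[where I = UNIV and
          f = "\<lambda>T w. chain_A \<mu> (\<lambda>n. e n w) (\<lambda>n. U n w) T 0"])
      (auto intro: measurable_chain measurable_compose[OF T])
qed

section \<open>Almost sure coalescence and exactness of the output\<close>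

theorem cftp_correct:
  fixes \<mu> :: "'e config pmf"
  assumes increasing: "\<And>\<omega> \<omega>'. \<omega> \<in> set_pmf \<mu> \<Longrightarrow> \<omega> \<le> \<omega>' \<Longrightarrow> \<omega>' \<in> set_pmf \<mu>"
    and top: "(\<lambda>_. True) \<in> set_pmf \<mu>"
  shows "prob {w \<in> space M. coalescence_time \<mu> (\<lambda>n. e n w) (\<lambda>n. U n w) < \<infinity>} = 1"
    and "distr M (count_space UNIV) (\<lambda>w. cftp_output \<mu> (\<lambda>n. e n w) (\<lambda>n. U n w)) = measure_pmf \<mu>"
proof -
  let ?T = "\<lambda>w. coalescence_time \<mu> (\<lambda>n. e n w) (\<lambda>n. U n w)"
  let ?out = "\<lambda>w. cftp_output \<mu> (\<lambda>n. e n w) (\<lambda>n. U n w)"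
  let ?run = "\<lambda>m x w. run_site \<mu> (\<lambda>n. e n w) (\<lambda>n. U n w) [1 - int m..0] x"
  obtain \<delta> where \<delta>: "0 < \<delta>" "\<delta> \<le> 1" "\<And>a \<xi>. \<delta> \<le> cond_open \<mu> a \<xi>"
    using cond_open_uniform_lower_bound[OF top] by blast
  define N where "N = CARD('e)"
  obtain h where h: "bij_betw h {..<N} (UNIV :: 'e set)"
    using ex_bij_betw_nat_finite[of "UNIV :: 'e set"] by (auto simp: N_def atLeast0LessThan)
  define bad where "bad J = {w \<in> space M. \<forall>j<J. \<not>
      (\<forall>i<N. e (- int (j * N + i)) w = h i \<and> U (- int (j * N + i)) w \<le> \<delta>)}" for J
  define q where "q = 1 - (\<delta> / CARD('e)) ^ N"
  have bad: "bad J \<in> events" "prob (bad J) = q ^ J" for J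
    unfolding bad_def q_def using prob_no_full_block[OF \<delta>(1,2) h] by blast+
  have "0 < (\<delta> / CARD('e)) ^ N"
    using \<delta>(1) by simp
  \<comment> \<open>With positivity of the power, this places \<open>q\<close> in
    \<open>[0, 1)\<close>, hence geometric decay.\<close>
  moreover have "\<delta> \<le> CARD('e)"
  proof -
    have "1 \<le> CARD('e)"
      by (simp add: Suc_le_eq)
    with \<delta>(2) show ?thesis
      by linarith
  qed
  then have "\<delta> / CARD('e) \<le> 1"
    by (simp add: divide_le_eq)
  then have "(\<delta> / CARD('e)) ^ N \<le> 1"
    using \<delta>(1) by (intro power_le_one) auto
  ultimately have "(\<lambda>J. q ^ J) \<longlonglongrightarrow> 0"
    by (intro LIMSEQ_power_zero) (auto simp: q_def)
  \<comment> \<open>Both conclusions are reduced to this: one constant is the probability of no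
    coalescence, the other the error in a point mass of the output law.\<close>
  then have lim0: "c = 0" if "\<And>J. \<bar>c\<bar> \<le> q ^ J" for c :: real
    using LIMSEQ_le_const[of "\<lambda>J. q ^ J" 0 "\<bar>c\<bar>"] that by auto
  \<comment> \<open>Outside \<open>bad J\<close> one of the first \<open>J\<close> blocks is full,
    so some start at most \<open>J * N\<close> steps back coalesces.\<close>
  have good: "\<exists>m\<le>J * N. chain_A \<mu> (\<lambda>n. e n w) (\<lambda>n. U n w) m 0 = chain_B \<mu> (\<lambda>n. e n w) (\<lambda>n. U n w) m 0"
    if "w \<in> space M - bad J" for w J
  proof -
    obtain j where "j < J"
      and j: "\<forall>i<N. e (- int (j * N + i)) w = h i \<and> U (- int (j * N + i)) w \<le> \<delta>"
      using \<open>w \<in> space M - bad J\<close> unfolding bad_def by blast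
    from this(1) have "Suc j * N \<le> J * N"
      by (intro mult_le_mono1 Suc_leI)
    moreover have "chain_A \<mu> (\<lambda>n. e n w) (\<lambda>n. U n w) (Suc j * N) 0 =
        chain_B \<mu> (\<lambda>n. e n w) (\<lambda>n. U n w) (Suc j * N) 0"
      by (rule chain_coalesces_in_block[OF \<delta>(3) h j])
    ultimately show ?thesis
      by (intro exI conjI)
  qed
  have "Measurable.pred M (\<lambda>w. ?T w < \<infinity>)"
    unfolding coalescence_time_finite_iff by (intro pred_intros_countable pred_coalesced)
  then have "prob {w \<in> space M. \<not> ?T w < \<infinity>} = 1 - prob {w \<in> space M. ?T w < \<infinity>}"
    by (intro prob_neg predE)
  moreover have "prob {w \<in> space M. \<not> ?T w < \<infinity>} = 0"
  proof (rule lim0)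
    fix J
    have "{w \<in> space M. \<not> ?T w < \<infinity>} \<subseteq> bad J"
    proof
      fix w assume w: "w \<in> {w \<in> space M. \<not> ?T w < \<infinity>}"
      show "w \<in> bad J"
      proof (rule ccontr)
        assume "w \<notin> bad J"
        with w obtain m where "chain_A \<mu> (\<lambda>n. e n w) (\<lambda>n. U n w) m 0 = chain_B \<mu> (\<lambda>n. e n w) (\<lambda>n. U n w) m 0"
          using good[of w J] by blast
        then have "?T w < \<infinity>"
          unfolding coalescence_time_finite_iff by (rule exI)
        with w show False
          by simp
      qed
    qed
    from finite_measure_mono[OF this bad(1)]
    show "\<bar>prob {w \<in> space M. \<not> ?T w < \<infinity>}\<bar> \<le> q ^ J"
      by (simp add: bad(2))
  qed
  ultimately show "prob {w \<in> space M. ?T w < \<infinity>} = 1"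
    by linarith
  have prob_out: "prob (?out -` {y} \<inter> space M) = pmf \<mu> y" for y
  proof -
    have "\<bar>pmf \<mu> y - prob (?out -` {y} \<inter> space M)\<bar> \<le> q ^ J" for J
    proof -
      let ?R = "\<lambda>x. ?run (J * N) x -` {y} \<inter> space M"
      let ?O = "?out -` {y} \<inter> space M"
      have O: "?O \<in> events"
        by (rule measurable_sets[OF measurable_cftp_output]) auto
      have R: "?R x \<in> events" for x
        by (rule measurable_sets[OF measurable_run_site]) auto
      have eq: "?run (J * N) x w = ?out w" if w: "w \<in> space M - bad J" for w x
        using good[OF w] by (elim exE conjE) (rule cftp_output_eq_run_site)
      \<comment> \<open>Off \<open>bad J\<close> the run and the output agree from every initial
        state \<open>x\<close>, so the two events differ only inside \<open>bad J\<close>.\<close>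
      have close: "\<bar>prob (?R x) - prob ?O\<bar> \<le> q ^ J" for x
      proof -
        have "?R x \<subseteq> ?O \<union> bad J" "?O \<subseteq> ?R x \<union> bad J"
          using eq by auto
        then have "prob (?R x) \<le> prob (?O \<union> bad J)" "prob ?O \<le> prob (?R x \<union> bad J)"
          using O R bad by (auto intro!: finite_measure_mono)
        moreover have "prob (?O \<union> bad J) \<le> prob ?O + q ^ J" "prob (?R x \<union> bad J) \<le> prob (?R x) + q ^ J"
          using measure_Un_le[OF O bad(1)] measure_Un_le[OF R bad(1)] by (simp_all add: bad(2))
        ultimately show ?thesis
          by linarith
      qed
      have total: "(\<Sum>x\<in>UNIV. pmf \<mu> x) = 1"
        by (rule sum_pmf_eq_1) auto
      have R_eq: "?R x = {w \<in> space M. ?run (J * N) x w = y}" for x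
        by auto
      \<comment> \<open>Stationarity writes \<open>pmf \<mu> y\<close> as a
        \<open>\<mu>\<close>-average of the run probabilities. The weights sum to 1, so the fixed
        number \<open>prob ?O\<close> can be put under the same average.\<close>
      have "pmf \<mu> y - prob ?O = (\<Sum>x\<in>UNIV. pmf \<mu> x * (prob (?R x) - prob ?O))"
        unfolding right_diff_distrib sum_subtractf sum_distrib_right[symmetric] total R_eq
        by (simp add: run_site_preserves[OF increasing top] del: of_nat_mult)
      also have "\<bar>\<dots>\<bar> \<le> (\<Sum>x\<in>UNIV. pmf \<mu> x * q ^ J)"
        using close by (intro order_trans[OF sum_abs] sum_mono) (auto simp: abs_mult intro: mult_left_mono)
      also have "\<dots> = q ^ J"
        by (simp add: sum_distrib_right[symmetric] total)
      finally show ?thesis .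
    qed
    then show ?thesis
      using lim0[of "pmf \<mu> y - prob (?out -` {y} \<inter> space M)"] by simp
  qed
  show "distr M (count_space UNIV) ?out = measure_pmf \<mu>"
  proof (rule measure_eqI_finite[of _ UNIV])
    fix y
    have "emeasure (distr M (count_space UNIV) ?out) {y} = ennreal (pmf \<mu> y)"
      using prob_out by (simp add: emeasure_distr measurable_cftp_output emeasure_eq_measure)
    then show "emeasure (distr M (count_space UNIV) ?out) {y} = emeasure (measure_pmf \<mu>) {y}"
      by (simp add: emeasure_pmf_single)
  qed auto
qed

end

text \<open>Measurability of the output belongs to the conclusion because \<open>distr\<close>
  represents a law only for a measurable map.\<close>

theorem theorem4p3:
  fixes \<mu> :: "('e::finite \<Rightarrow> bool) pmf"
    and M :: "'w measure"
    and e :: "int \<Rightarrow> 'w \<Rightarrow> 'e"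
    and U :: "int \<Rightarrow> 'w \<Rightarrow> real"
  assumes increasing: "\<And>\<omega> \<omega>'. \<omega> \<in> set_pmf \<mu> \<Longrightarrow> \<omega> \<le> \<omega>' \<Longrightarrow> \<omega>' \<in> set_pmf \<mu>"
    and one_in_support: "(\<lambda>_. True) \<in> set_pmf \<mu>"
    and "prob_space M"
    and indep_pairs: "prob_space.indep_vars M (\<lambda>_. count_space UNIV \<Otimes>\<^sub>M borel)
           (\<lambda>n x. (e n x, U n x)) {..0}"
    and indep_within: "\<And>n. n \<le> 0 \<Longrightarrow>
           prob_space.indep_set M
             {e n -` C \<inter> space M |C. C \<in> sets (count_space UNIV)}
             {U n -` D \<inter> space M |D. D \<in> sets borel}"
    and unif_e: "\<And>n. n \<le> 0 \<Longrightarrow>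
           distr M (count_space UNIV) (e n) = uniform_count_measure UNIV"
    and unif_U: "\<And>n. n \<le> 0 \<Longrightarrow> distr M borel (U n) = uniform_measure lborel {0..1}"
  shows "measure M
           {x \<in> space M. coalescence_time \<mu> (\<lambda>n. e n x) (\<lambda>n. U n x) < \<infinity>} = 1
       \<and> (\<lambda>x. cftp_output \<mu> (\<lambda>n. e n x) (\<lambda>n. U n x)) \<in> measurable M (count_space UNIV)
       \<and> distr M (count_space UNIV) (\<lambda>x. cftp_output \<mu> (\<lambda>n. e n x) (\<lambda>n. U n x)) = measure_pmf \<mu>"
proof -
  interpret cftp_source M e U
    using assms by (intro cftp_source.intro cftp_source_axioms.intro)
  show ?thesis
    using cftp_correct[OF increasing one_in_support] measurable_cftp_output by simp
qed

end
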